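(* Let $I=[0,2\pi]$, let $k,f\in C^0(I,\mathbb{R})$, and put $\theta(t)=\int_0^t k(s)\,\mathrm{d}s$ and $\phi(t)=\int_0^t f(s)\,\mathrm{d}s$ for $t\in I$. The following conditions are equivalent. (0) The curve with curvature $k+\lambda f$ is closed for all $\lambda\in\mathbb{R}$. (1) $\int_0^{2\pi}\mathrm{e}^{i\theta(t)}\phi(t)^n\,\mathrm{d}t=0$ for all $n\in\mathbb{N}_0$. (2) $\int_0^{2\pi}\mathrm{e}^{i\theta(t)}g(\phi(t))^n\,\mathrm{d}t=0$ for all $n\in\mathbb{N}_0$ and any $g$ bounded and integrable. Moreover, these conditions imply the following: whenever $a\neq\phi(0),\phi(2\pi)$ is a regular value of $\phi$, $$\sum_{b\in\phi^{-1}(a)}\frac{\mathrm{e}^{i\theta(b)}}{|\phi'(b)|}=0.$$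
   Context: $\mathbb{R}^2$ is identified with $\mathbb{C}$. For a continuous function $\kappa:I\to\mathbb{R}$ on $I=[0,2\pi]$, the curve with curvature $\kappa$ is the arc-length parametrized planar curve $\gamma(t)=\int_0^t \mathrm{e}^{i\vartheta(s)}\,\mathrm{d}s$ with $\vartheta(t)=\int_0^t\kappa(s)\,\mathrm{d}s$; it is unique up to rigid motions. A curve $\gamma$ on $I$ is closed if its starting and end point coincide, i.e. $\gamma(0)=\gamma(2\pi)$ (no condition on derivatives). $\mathbb{N}_0=\{0,1,2,\dots\}$, and a zeroth power is the constant $1$. In (2), $g$ is a function of a real variable and $g(\phi(t))$ denotes its composition with $\phi$. A number $a\in\mathbb{R}$ is a regular value of $\phi$ if $\phi'(t)\neq 0$ for all $t\in\phi^{-1}(a)=\{t\in I:\phi(t)=a\}$; then $\phi^{-1}(a)$ is finite. An empty sum is $0$.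
   Formalization: In (2), g is additionally required to have g∘φ measurable on I; for some bounded integrable g (where φ' vanishes on a set of positive measure) g∘φ is not measurable and the integral in (2) is undefined. *)

theory Defs
  imports "HOL-Analysis.Analysis"
begin

abbreviation I2pi :: "real set" where
  "I2pi \<equiv> {0..2 * pi}"

definition tangent_angle :: "(real \<Rightarrow> real) \<Rightarrow> real \<Rightarrow> real" where
  "tangent_angle \<kappa> t = integral {0..t} \<kappa>"

definition curve_of_curvature :: "(real \<Rightarrow> real) \<Rightarrow> real \<Rightarrow> complex" where
  "curve_of_curvature \<kappa> t = integral {0..t} (\<lambda>s. cis (tangent_angle \<kappa> s))"

text \<open>No condition on derivatives at the end points.\<close>

definition closed_curve :: "(real \<Rightarrow> complex) \<Rightarrow> bool" where
  "closed_curve \<gamma> \<longleftrightarrow> \<gamma> 0 = \<gamma> (2 * pi)"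

text \<open>The derivative is taken within the interval, hence is one-sided at its end points.\<close>

definition deriv_on_I :: "(real \<Rightarrow> real) \<Rightarrow> real \<Rightarrow> real" where
  "deriv_on_I \<phi> t = vector_derivative \<phi> (at t within I2pi)"

definition fibre :: "(real \<Rightarrow> real) \<Rightarrow> real \<Rightarrow> real set" where
  "fibre \<phi> a = {t \<in> I2pi. \<phi> t = a}"

definition regular_value :: "(real \<Rightarrow> real) \<Rightarrow> real \<Rightarrow> bool" where
  "regular_value \<phi> a \<longleftrightarrow> (\<forall>t \<in> fibre \<phi> a. deriv_on_I \<phi> t \<noteq> 0)"

text \<open>
  The functions \<open>g\<close> admitted in the composition condition: bounded, Lebesgue integrable on the
  real line, and such that \<open>g \<circ> \<phi>\<close> is measurable on the interval. The last clause only says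
  that the integrals of \<open>g (\<phi> t) ^ n\<close> against \<open>cis (\<theta> t)\<close> make sense. It holds for
  every Borel function \<open>g\<close>, but not for every Lebesgue (or Riemann) integrable one: if
  \<open>\<phi>\<close> is strictly increasing with vanishing derivative on a fat Cantor set \<open>C\<close>, then
  \<open>\<phi> ` C\<close> is a compact null set, and the indicator of \<open>\<phi> ` N\<close> with \<open>N \<subseteq> C\<close>
  non-measurable is integrable with non-measurable composition.
\<close>

definition admissible :: "(real \<Rightarrow> real) \<Rightarrow> (real \<Rightarrow> real) \<Rightarrow> bool" where
  "admissible \<phi> g \<longleftrightarrow> bounded (range g) \<and> integrable lebesgue g \<and>
     (\<lambda>t. g (\<phi> t)) \<in> borel_measurable (lebesgue_on I2pi)"

end

theory Submission
  imports Defs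
begin

text \<open>
  Write \<open>w t = cis (\<theta> t)\<close>. The curve with curvature \<open>k + l * f\<close> closes up exactly when
  the integral of \<open>w t * cis (l * \<phi> t)\<close> over the interval vanishes. This integral is the Fourier
  transform at \<open>l\<close> of the complex measure obtained by pushing \<open>w t dt\<close> forward along \<open>\<phi>\<close>, and
  all conditions of the theorem say that this compactly supported measure is zero, tested against
  different classes of functions: exponentials, monomials, and bounded functions.

  Exponentials give monomials by differentiating \<open>n\<close> times under the integral sign at \<open>l = 0\<close>
  (\<open>cis_tests_imp_vanishing_moments\<close>). Monomials give all continuous functions by the Weierstrass
  approximation theorem (\<open>integral_continuous_test\<close>), in particular the exponentials again. The step
  to bounded functions \<open>h\<close> (\<open>integral_bounded_test\<close>) needs care because \<open>h\<close> may fail to be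
  a Borel function and only \<open>h \<circ> \<phi>\<close> is measurable on the interval. The point is that level sets of \<open>h \<circ> \<phi>\<close> are unions of fibres of \<open>\<phi>\<close>:
  if \<open>E\<close> is such a set and \<open>T \<subseteq> E\<close> is compact and nearly exhausts \<open>E\<close>, then the preimage of the
  compact set \<open>\<phi> ` T\<close> lies between \<open>T\<close> and \<open>E\<close>. Thus \<open>E\<close> agrees, up to a small set, with the preimage
  of a closed set, whose indicator is a limit of continuous functions (\<open>integral_saturated\<close>).
  Conversely, the identity truncated to the compact range of \<open>\<phi>\<close> is a bounded integrable function
  that recovers the monomials.

  The sum over the fibre of a regular value \<open>y\<close> is the density of the push-forward measure at \<open>y\<close>.
  Testing against a narrow tent function centred at \<open>y\<close> localises the integral to small intervals
  around the finitely many fibre points. Around each of them \<open>\<phi>\<close> is a valid change of variables, so the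
  contribution is close to \<open>w p / of_real \<bar>f p\<bar>\<close> times the mass of the tent
  (\<open>integral_near_regular_point\<close>). At an end point of the interval the tent would be seen from one
  side only, which is why the values there are excluded.
\<close>

section \<open>Weights whose moments along a function vanish\<close>

lemma eq_zero_if_norm_le_mult:
  fixes x :: "'a::real_normed_vector"
  assumes "\<And>e. e > 0 \<Longrightarrow> norm x \<le> e * K"
  shows "x = 0"
proof -
  have lim: "((\<lambda>e. e * K) \<longlongrightarrow> 0 * K) (at_right 0)"
    by (intro tendsto_intros)
  have "norm x \<le> 0 * K"
    using assms by (intro tendsto_lowerbound[OF lim])
      (auto intro!: eventually_mono[OF eventually_at_right_less[of 0]])
  then show ?thesis by simp
qed

text \<open>
  The hypotheses say that the complex measure \<open>w t dt\<close> on \<open>{a..b}\<close>, pushed forward along \<open>\<phi>\<close>, has the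
  moments of the zero measure.
\<close>

locale vanishing_moments =
  fixes a b :: real and w :: "real \<Rightarrow> complex" and \<phi> :: "real \<Rightarrow> real"
  assumes cont_w: "continuous_on {a..b} w"
    and cont_phi: "continuous_on {a..b} \<phi>"
    and moments: "\<And>n. integral {a..b} (\<lambda>t. w t * of_real (\<phi> t ^ n)) = 0"
begin

lemma weight_bound:
  obtains M where "M > 0" "\<And>t. t \<in> {a..b} \<Longrightarrow> norm (w t) \<le> M"
proof -
  have "bounded (w ` {a..b})"
    using cont_w by (intro compact_imp_bounded compact_continuous_image) auto
  then show thesis
    using that unfolding bounded_pos by auto
qed

text \<open>
  By linearity the integral vanishes for polynomials \<open>h\<close>, and on the compact range of \<open>\<phi>\<close> polynomials
  approximate every continuous function uniformly.
\<close>

lemma integral_continuous_test: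
  fixes h :: "real \<Rightarrow> real"
  assumes h: "continuous_on (\<phi> ` {a..b}) h"
  shows "integral {a..b} (\<lambda>t. w t * of_real (h (\<phi> t))) = 0"
proof (cases "a \<le> b")
  case ab: True
  obtain M where M: "M > 0" "\<And>t. t \<in> {a..b} \<Longrightarrow> norm (w t) \<le> M"
    using weight_bound by blast
  have hphi: "continuous_on {a..b} (\<lambda>t. h (\<phi> t))"
    using continuous_on_compose2[OF h cont_phi] by auto
  have int_h: "(\<lambda>t. w t * of_real (h (\<phi> t))) integrable_on {a..b}"
    by (intro integrable_continuous_interval continuous_intros cont_w hphi)
  have small: "norm (integral {a..b} (\<lambda>t. w t * of_real (h (\<phi> t)))) \<le> e * (M * (b - a))"
    if "e > 0" for e
  proof -
    have comp: "compact (\<phi> ` {a..b})"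
      using cont_phi by (intro compact_continuous_image) auto
    obtain p where p: "real_polynomial_function p"
      and close: "\<And>x. x \<in> \<phi> ` {a..b} \<Longrightarrow> \<bar>h x - p x\<bar> < e"
      using Stone_Weierstrass_real_polynomial_function[OF comp h \<open>e > 0\<close>] by blast
    obtain c n where pc: "p = (\<lambda>x. \<Sum>i\<le>n. c i * x ^ i)"
      using p real_polynomial_function_iff_sum by blast
    have int_i: "(\<lambda>t. of_real (c i) * (w t * of_real (\<phi> t ^ i))) integrable_on {a..b}" for i
      by (intro integrable_continuous_interval continuous_intros cont_w cont_phi)
    have "integral {a..b} (\<lambda>t. w t * of_real (p (\<phi> t)))
        = integral {a..b} (\<lambda>t. \<Sum>i\<le>n. of_real (c i) * (w t * of_real (\<phi> t ^ i)))"
      unfolding pc by (intro integral_cong) (simp add: sum_distrib_left mult_ac)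
    also have "\<dots> = (\<Sum>i\<le>n. integral {a..b} (\<lambda>t. of_real (c i) * (w t * of_real (\<phi> t ^ i))))"
      using int_i by (intro integral_sum) auto
    also have "\<dots> = 0"
      using moments by (simp only: integral_mult_right mult_zero_right sum.neutral_const)
    finally have p0: "integral {a..b} (\<lambda>t. w t * of_real (p (\<phi> t))) = 0" .
    have cont_p: "continuous_on {a..b} (\<lambda>t. p (\<phi> t))"
      unfolding pc by (intro continuous_intros cont_phi)
    have int_p: "(\<lambda>t. w t * of_real (p (\<phi> t))) integrable_on {a..b}"
      by (intro integrable_continuous_interval continuous_intros cont_w cont_p)
    have "integral {a..b} (\<lambda>t. w t * of_real (h (\<phi> t)))
        = integral {a..b} (\<lambda>t. w t * of_real (h (\<phi> t)) - w t * of_real (p (\<phi> t)))"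
      using integral_diff[OF int_h int_p] p0 by simp
    also have "\<dots> = integral {a..b} (\<lambda>t. w t * of_real (h (\<phi> t) - p (\<phi> t)))"
      by (simp add: algebra_simps)
    also have "norm \<dots> \<le> (M * e) * (b - a)"
    proof (rule integral_bound[OF ab])
      show "continuous_on {a..b} (\<lambda>t. w t * of_real (h (\<phi> t) - p (\<phi> t)))"
        by (intro continuous_intros cont_w hphi cont_p)
      show "norm (w t * of_real (h (\<phi> t) - p (\<phi> t))) \<le> M * e" if "t \<in> {a..b}" for t
        using M(2)[OF that] close[of "\<phi> t"] that M(1)
        by (simp add: norm_mult mult_mono less_imp_le del: of_real_diff)
    qed
    finally show ?thesis by (simp add: mult_ac)
  qed
  then show ?thesis by (rule eq_zero_if_norm_le_mult)
qed auto

text \<open>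
  For nonempty \<open>C\<close> the continuous functions \<open>max 0 (1 - n * infdist x C)\<close> decrease to the indicator
  of \<open>C\<close>, so dominated convergence applies.
\<close>

lemma integral_preimage_closed:
  assumes "closed C"
  shows "integral {t \<in> {a..b}. \<phi> t \<in> C} w = 0"
proof (cases "C = {}")
  case False
  define g where "g n x = max 0 (1 - real n * infdist x C)" for n x
  have cont_g: "continuous_on S (g n)" for n S
    unfolding g_def by (intro continuous_intros)
  have cont_gphi: "continuous_on {a..b} (\<lambda>t. g n (\<phi> t))" for n
    using continuous_on_compose2[OF cont_g cont_phi] by auto
  have lim_g: "(\<lambda>n. g n x) \<longlonglongrightarrow> (if x \<in> C then 1 else 0)" for x
  proof (cases "x \<in> C")
    case True
    then show ?thesis by (simp add: g_def)
  next
    case nx: False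
    then have pos: "infdist x C > 0"
      using assms False by (simp add: infdist_pos_not_in_closed)
    obtain N where N: "1 < real N * infdist x C"
      using reals_Archimedean3[OF pos] by blast
    have "g n x = 0" if "n \<ge> N" for n
    proof -
      have "real N * infdist x C \<le> real n * infdist x C"
        using that pos by (intro mult_right_mono) auto
      then show ?thesis using N by (simp add: g_def)
    qed
    then show ?thesis
      using nx by (auto intro!: tendsto_eventually eventually_sequentiallyI)
  qed
  have "(\<lambda>n. integral {a..b} (\<lambda>t. w t * of_real (g n (\<phi> t))))
      \<longlonglongrightarrow> integral {a..b} (\<lambda>t. if t \<in> {t \<in> {a..b}. \<phi> t \<in> C} then w t else 0)"
  proof (rule dominated_convergence)
    show "(\<lambda>t. w t * of_real (g n (\<phi> t))) integrable_on {a..b}" for n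
      by (intro integrable_continuous_interval continuous_intros cont_w cont_gphi)
    show "(\<lambda>t. norm (w t)) integrable_on {a..b}"
      by (intro integrable_continuous_interval continuous_intros cont_w)
    show "norm (w t * of_real (g n (\<phi> t))) \<le> norm (w t)" for n t
      by (auto simp: norm_mult g_def infdist_nonneg intro!: mult_left_le)
    show "(\<lambda>n. w t * of_real (g n (\<phi> t)))
        \<longlonglongrightarrow> (if t \<in> {t \<in> {a..b}. \<phi> t \<in> C} then w t else 0)" if "t \<in> {a..b}" for t
      using tendsto_mult[OF tendsto_const tendsto_of_real[OF lim_g[of "\<phi> t"]], of "w t"] that
      by (auto split: if_splits)
  qed
  moreover have "integral {a..b} (\<lambda>t. w t * of_real (g n (\<phi> t))) = 0" for n
    by (rule integral_continuous_test[OF cont_g])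
  ultimately have "integral {a..b} (\<lambda>t. if t \<in> {t \<in> {a..b}. \<phi> t \<in> C} then w t else 0) = 0"
    by (simp add: LIMSEQ_const_iff)
  moreover have "{t \<in> {a..b}. \<phi> t \<in> C} \<inter> {a..b} = {t \<in> {a..b}. \<phi> t \<in> C}" by auto
  ultimately show ?thesis
    unfolding integral_restrict_Int by metis
qed auto

lemma weight_integrable_on:
  assumes "E \<in> sets lebesgue" "E \<subseteq> {a..b}"
  shows "w integrable_on E"
  using set_integrable_subset[OF absolutely_integrable_continuous_real[OF cont_w] assms]
  by (rule set_lebesgue_integral_eq_integral(1))

text \<open>
  Here \<open>A\<close> may be far from Borel; inner regularity is applied to its preimage \<open>E\<close> instead. For a closed
  \<open>T \<subseteq> E\<close>, the set \<open>\<phi> ` T\<close> is compact and its preimage \<open>F\<close> satisfies \<open>T \<subseteq> F \<subseteq> E\<close>. The integral over \<open>F\<close> vanishes, and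
  \<open>E - F\<close> is as small as \<open>E - T\<close>.
\<close>

lemma integral_saturated:
  assumes meas: "{t \<in> {a..b}. \<phi> t \<in> A} \<in> sets lebesgue"
  shows "integral {t \<in> {a..b}. \<phi> t \<in> A} w = 0"
proof -
  define E where "E = {t \<in> {a..b}. \<phi> t \<in> A}"
  have E: "E \<in> sets lebesgue" "E \<subseteq> {a..b}"
    using meas by (auto simp: E_def)
  obtain M where M: "M > 0" "\<And>t. t \<in> {a..b} \<Longrightarrow> norm (w t) \<le> M"
    using weight_bound by blast
  have small: "norm (integral E w) \<le> e * M" if "e > 0" for e
  proof -
    obtain T where T: "closed T" "T \<subseteq> E" "E - T \<in> lmeasurable"
        "emeasure lebesgue (E - T) < ennreal e"
      using sets_lebesgue_inner_closed[OF E(1) \<open>e > 0\<close>] by metis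
    have "T = T \<inter> {a..b}" using T E by auto
    then have "compact T" using T(1) closed_Int_compact by (metis compact_Icc)
    then have "compact (\<phi> ` T)"
      using T E by (intro compact_continuous_image continuous_on_subset[OF cont_phi]) auto
    then have clo: "closed (\<phi> ` T)" by (rule compact_imp_closed)
    define F where "F = {t \<in> {a..b}. \<phi> t \<in> \<phi> ` T}"
    have TF: "T \<subseteq> F" and FE: "F \<subseteq> E"
      using T(2) by (auto simp: F_def E_def)
    have "closed ({a..b} \<inter> \<phi> -` (\<phi> ` T))"
      using clo by (intro continuous_closed_preimage cont_phi) auto
    moreover have "F = {a..b} \<inter> \<phi> -` (\<phi> ` T)" by (auto simp: F_def)
    ultimately have F: "F \<in> sets lebesgue" by (simp add: borel_closed)
    have EF: "E - F \<in> sets lebesgue" using E F by blast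
    have EFm: "E - F \<in> lmeasurable"
      using fmeasurableI2[OF T(3) _ EF] TF by auto
    have "measure lebesgue (E - F) \<le> measure lebesgue (E - T)"
      using TF T(3) EF by (intro measure_mono_fmeasurable) auto
    also have "\<dots> \<le> e"
      using T(3,4) \<open>e > 0\<close> by (simp add: emeasure_eq_measure2 ennreal_less_iff less_imp_le)
    finally have me: "measure lebesgue (E - F) \<le> e" .
    have "((\<lambda>t. w t) has_integral (integral F w + integral (E - F) w)) (F \<union> (E - F))"
      using E F EF FE by (intro has_integral_Un integrable_integral weight_integrable_on) auto
    moreover have "F \<union> (E - F) = E" using FE by auto
    moreover have "integral F w = 0"
      unfolding F_def by (rule integral_preimage_closed[OF clo])
    ultimately have "integral E w = integral (E - F) w"
      by (simp add: integral_unique)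
    also have "norm \<dots> \<le> integral (E - F) (\<lambda>_. M)"
    proof (rule integral_norm_bound_integral)
      show "w integrable_on E - F" using E EF by (intro weight_integrable_on) auto
      show "(\<lambda>_. M) integrable_on E - F" using EFm by (rule integrable_on_const)
      show "norm (w t) \<le> M" if "t \<in> E - F" for t using that M(2) E(2) by auto
    qed
    also have "\<dots> = measure lebesgue (E - F) * M"
      using lmeasure_integral[OF EFm] integral_mult_right[of "E - F" M "\<lambda>_. 1"]
      by (simp add: mult.commute)
    also have "\<dots> \<le> e * M" using me M(1) by simp
    finally show ?thesis .
  qed
  then have "integral E w = 0" by (rule eq_zero_if_norm_le_mult)
  then show ?thesis by (simp add: E_def)
qed

text \<open>
  Rounding \<open>h\<close> down to multiples of \<open>e\<close> makes \<open>h \<circ> \<phi>\<close> a finite combination of indicators of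
  measurable sets that are preimages under \<open>\<phi>\<close>; the rounding error is at most \<open>e\<close>.
\<close>

lemma integral_bounded_test:
  fixes h :: "real \<Rightarrow> real"
  assumes bdd: "\<And>x. \<bar>h x\<bar> \<le> G"
    and meas: "(\<lambda>t. h (\<phi> t)) \<in> borel_measurable (lebesgue_on {a..b})"
  shows "integral {a..b} (\<lambda>t. w t * of_real (h (\<phi> t))) = 0"
proof (cases "a \<le> b")
  case ab: True
  obtain M where M: "M > 0" "\<And>t. t \<in> {a..b} \<Longrightarrow> norm (w t) \<le> M"
    using weight_bound by blast
  have "(\<lambda>t. w t * of_real (h (\<phi> t))) \<in> borel_measurable (lebesgue_on {a..b})"
    using measurable_compose[OF meas borel_measurable_of_real] continuous_imp_measurable_on_sets_lebesgue[OF cont_w]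
    by (intro borel_measurable_times) auto
  then have int_h: "(\<lambda>t. w t * of_real (h (\<phi> t))) integrable_on {a..b}"
  proof (rule measurable_bounded_by_integrable_imp_integrable)
    show "(\<lambda>_. M * G) integrable_on {a..b}" by auto
    show "norm (w t * of_real (h (\<phi> t))) \<le> M * G" if "t \<in> {a..b}" for t
      using M(2)[OF that] M(1) bdd by (simp add: norm_mult mult_mono)
  qed auto
  have small: "norm (integral {a..b} (\<lambda>t. w t * of_real (h (\<phi> t)))) \<le> e * (M * (b - a))"
    if "e > 0" for e
  proof -
    define E where "E j = {t \<in> {a..b}. \<phi> t \<in> {x. \<lfloor>h x / e\<rfloor> = j}}" for j
    define J where "J = {\<lfloor>- G / e\<rfloor>..\<lfloor>G / e\<rfloor>}"
    have E_sets: "E j \<in> sets lebesgue" for j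
    proof -
      have "{t \<in> space (lebesgue_on {a..b}). \<lfloor>h (\<phi> t) / e\<rfloor> = j} \<in> sets (lebesgue_on {a..b})"
        using meas by measurable
      then show ?thesis
        by (simp add: E_def sets_restrict_space_iff)
    qed
    define s where "s t = (\<Sum>j\<in>J. of_real (e * of_int j) * (if t \<in> E j then w t else 0))" for t
    have E_Int: "E j \<inter> {a..b} = E j" for j
      by (auto simp: E_def)
    have int_E: "(\<lambda>t. if t \<in> E j then w t else 0) integrable_on {a..b}" for j
      using weight_integrable_on[OF E_sets[of j]] E_Int[of j]
      unfolding integrable_restrict_Int by (metis Int_commute Int_lower2)
    have int_s: "s integrable_on {a..b}"
      unfolding s_def by (intro integrable_sum integrable_on_mult_right int_E) (auto simp: J_def)
    have "integral {a..b} s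
        = (\<Sum>j\<in>J. of_real (e * of_int j) * integral {a..b} (\<lambda>t. if t \<in> E j then w t else 0))"
      unfolding s_def using int_E
      by (subst integral_sum) (auto simp: J_def intro!: integrable_on_mult_right)
    also have "\<dots> = (\<Sum>j\<in>J. of_real (e * of_int j) * integral (E j) w)"
      unfolding integral_restrict_Int by (simp add: E_Int)
    also have "\<dots> = 0"
      using integral_saturated[OF E_sets[unfolded E_def]] by (simp add: E_def)
    finally have s0: "integral {a..b} s = 0" .
    have s_eq: "s t = w t * of_real (e * \<lfloor>h (\<phi> t) / e\<rfloor>)" if "t \<in> {a..b}" for t
    proof -
      have J: "\<lfloor>h (\<phi> t) / e\<rfloor> \<in> J"
        using bdd[of "\<phi> t"] \<open>e > 0\<close>
        by (auto simp: J_def abs_le_iff field_simps intro!: floor_mono)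
      have "s t = (\<Sum>j\<in>J. if j = \<lfloor>h (\<phi> t) / e\<rfloor> then of_real (e * of_int j) * w t else 0)"
        unfolding s_def using that by (intro sum.cong) (auto simp: E_def)
      also have "\<dots> = w t * of_real (e * \<lfloor>h (\<phi> t) / e\<rfloor>)"
        using J by (subst sum.delta) (auto simp: J_def mult.commute)
      finally show ?thesis .
    qed
    have "integral {a..b} (\<lambda>t. w t * of_real (h (\<phi> t)))
        = integral {a..b} (\<lambda>t. w t * of_real (h (\<phi> t)) - s t)"
      using integral_diff[OF int_h int_s] s0 by simp
    also have "norm \<dots> \<le> integral {a..b} (\<lambda>_. M * e)"
    proof (rule integral_norm_bound_integral)
      show "(\<lambda>t. w t * of_real (h (\<phi> t)) - s t) integrable_on {a..b}"
        by (intro integrable_diff int_h int_s)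
      show "(\<lambda>_. M * e) integrable_on {a..b}" by auto
      show "norm (w t * of_real (h (\<phi> t)) - s t) \<le> M * e" if "t \<in> {a..b}" for t
      proof -
        have "w t * of_real (h (\<phi> t)) - s t
            = w t * of_real (h (\<phi> t) - e * \<lfloor>h (\<phi> t) / e\<rfloor>)"
          using s_eq[OF that] by (simp add: algebra_simps)
        moreover have "\<bar>h (\<phi> t) - e * \<lfloor>h (\<phi> t) / e\<rfloor>\<bar> \<le> e"
        proof -
          have "h (\<phi> t) - e * \<lfloor>h (\<phi> t) / e\<rfloor> = e * frac (h (\<phi> t) / e)"
            using \<open>e > 0\<close> by (simp add: frac_def algebra_simps)
          then show ?thesis
            using \<open>e > 0\<close> frac_ge_0[of "h (\<phi> t) / e"] frac_lt_1[of "h (\<phi> t) / e"]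
            by (simp add: abs_mult mult_left_le)
        qed
        ultimately show ?thesis
          using M(2)[OF that] M(1) by (simp add: norm_mult mult_mono del: of_real_diff)
      qed
    qed
    also have "\<dots> = e * (M * (b - a))" using ab by (simp add: mult_ac)
    finally show ?thesis .
  qed
  then show ?thesis by (rule eq_zero_if_norm_le_mult)
qed auto

end

section \<open>Exponential test functions\<close>

lemma (in vanishing_moments) integral_cis_test:
  "integral {a..b} (\<lambda>t. w t * cis (l * \<phi> t)) = 0"
proof -
  have "continuous_on {a..b} (\<lambda>t. w t * of_real (cos (l * \<phi> t)))"
       "continuous_on {a..b} (\<lambda>t. \<i> * (w t * of_real (sin (l * \<phi> t))))"
    by (intro continuous_intros cont_w cont_phi)+
  note int = this[THEN integrable_continuous_interval]
  have "integral {a..b} (\<lambda>t. w t * cis (l * \<phi> t))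
      = integral {a..b} (\<lambda>t. w t * of_real (cos (l * \<phi> t)) + \<i> * (w t * of_real (sin (l * \<phi> t))))"
    by (intro integral_cong) (simp add: cis_conv_exp[symmetric] complex_eq_iff algebra_simps)
  also have "\<dots> = integral {a..b} (\<lambda>t. w t * of_real (cos (l * \<phi> t)))
      + \<i> * integral {a..b} (\<lambda>t. w t * of_real (sin (l * \<phi> t)))"
    using int by (simp add: integral_add)
  also have "\<dots> = 0"
    using integral_continuous_test[of "\<lambda>x. cos (l * x)"] integral_continuous_test[of "\<lambda>x. sin (l * x)"]
    by (simp add: continuous_intros)
  finally show ?thesis .
qed

text \<open>
  With \<open>F n l\<close> the integral of \<open>w t * \<phi> t ^ n * cis (l * \<phi> t)\<close>, differentiation under the integral
  gives \<open>\<i> * F (Suc n) l\<close> as the derivative of \<open>F n\<close> at \<open>l\<close>. So \<open>F 0 = 0\<close> propagates to all \<open>F n\<close>, and the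
  moments are the values at \<open>l = 0\<close>.
\<close>

lemma cis_tests_imp_vanishing_moments:
  fixes w :: "real \<Rightarrow> complex" and \<phi> :: "real \<Rightarrow> real"
  assumes cont_w: "continuous_on {a..b} w" and cont_phi: "continuous_on {a..b} \<phi>"
    and zero: "\<And>l. integral {a..b} (\<lambda>t. w t * cis (l * \<phi> t)) = 0"
  shows "vanishing_moments a b w \<phi>"
proof
  define F where "F n l = integral {a..b} (\<lambda>t. w t * of_real (\<phi> t ^ n) * cis (l * \<phi> t))" for n l
  have F_deriv: "(F n has_vector_derivative \<i> * F (Suc n) l) (at l)" for n l
  proof -
    have "((\<lambda>l. integral (cbox a b) (\<lambda>t. w t * of_real (\<phi> t ^ n) * cis (l * \<phi> t)))
        has_vector_derivative
          integral (cbox a b) (\<lambda>t. \<i> * (w t * of_real (\<phi> t ^ Suc n) * cis (l * \<phi> t)))) (at l within UNIV)"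
    proof (rule leibniz_rule_vector_derivative)
      show "((\<lambda>l. w t * of_real (\<phi> t ^ n) * cis (l * \<phi> t)) has_vector_derivative
          \<i> * (w t * of_real (\<phi> t ^ Suc n) * cis (l * \<phi> t))) (at l within UNIV)" for l t
      proof -
        have "((\<lambda>l. cis (l * \<phi> t)) has_vector_derivative \<phi> t *\<^sub>R (\<i> * cis (l * \<phi> t))) (at l)"
          using has_derivative_cis[OF has_derivative_mult_left[OF has_derivative_ident], of "\<phi> t" l UNIV]
          by (simp add: has_vector_derivative_def mult_ac)
        from has_vector_derivative_mult_right[OF this, of "w t * of_real (\<phi> t ^ n)"]
        show ?thesis by (simp add: scaleR_conv_of_real mult_ac)
      qed
      show "(\<lambda>t. w t * of_real (\<phi> t ^ n) * cis (l * \<phi> t)) integrable_on cbox a b" for l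
        using cont_w cont_phi
        by (auto intro!: integrable_continuous_interval continuous_intros)
      have "continuous_on (UNIV \<times> {a..b}) (\<lambda>z. w (snd z))" "continuous_on (UNIV \<times> {a..b}) (\<lambda>z. \<phi> (snd z))"
        by (auto intro!: continuous_on_compose2[OF cont_w] continuous_on_compose2[OF cont_phi]
            continuous_intros)
      then show "continuous_on (UNIV \<times> cbox a b)
          (\<lambda>(l, t). \<i> * (w t * of_real (\<phi> t ^ Suc n) * cis (l * \<phi> t)))"
        unfolding case_prod_beta box_real by (intro continuous_intros)
    qed auto
    then show ?thesis by (simp add: F_def[abs_def])
  qed
  have F0: "F n l = 0" for n l
  proof (induction n arbitrary: l)
    case 0
    show ?case using zero by (simp add: F_def)
  next
    case (Suc n)
    have "F n = (\<lambda>_. 0)" using Suc by auto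
    then have "(F n has_vector_derivative 0) (at l)" by simp
    then have "\<i> * F (Suc n) l = 0"
      using F_deriv[of n l] by (rule vector_derivative_unique_at[rotated])
    then show ?case by simp
  qed
  show "integral {a..b} (\<lambda>t. w t * of_real (\<phi> t ^ n)) = 0" for n
    using F0[of n 0] by (simp add: F_def)
qed (fact cont_w cont_phi)+

section \<open>The density over a regular value\<close>

text \<open>
  On \<open>{c..d}\<close> the derivative has constant sign, so the substitution rule shows that
  \<open>\<bar>f t\<bar> * h (\<phi> t)\<close> has the same integral as \<open>h\<close>: the hypothesis on the end points places the support
  of \<open>h\<close> between \<open>\<phi> c\<close> and \<open>\<phi> d\<close>. The integrand \<open>w t * h (\<phi> t)\<close> is this nonnegative function times
  \<open>w t / of_real \<bar>f t\<bar>\<close>, which stays within \<open>e\<close> of its value at \<open>p\<close>.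
\<close>

lemma integral_near_regular_point:
  fixes \<phi> f h :: "real \<Rightarrow> real" and w :: "real \<Rightarrow> complex"
  assumes cd: "c < p" "p < d"
    and deriv: "\<And>t. t \<in> {c..d} \<Longrightarrow> (\<phi> has_field_derivative f t) (at t within {c..d})"
    and cont_f: "continuous_on {c..d} f" and nz: "\<And>t. t \<in> {c..d} \<Longrightarrow> f t \<noteq> 0"
    and cont_w: "continuous_on {c..d} w"
    and cont_h: "continuous_on UNIV h" and h_nonneg: "\<And>x. 0 \<le> h x"
    and supp: "\<And>x. \<eta> \<le> \<bar>x - \<phi> p\<bar> \<Longrightarrow> h x = 0"
    and ends: "\<eta> \<le> \<bar>\<phi> c - \<phi> p\<bar>" "\<eta> \<le> \<bar>\<phi> d - \<phi> p\<bar>"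
    and osc: "\<And>t. t \<in> {c..d} \<Longrightarrow>
          norm (w t / of_real \<bar>f t\<bar> - w p / of_real \<bar>f p\<bar>) \<le> e"
  shows "norm (integral {c..d} (\<lambda>t. w t * of_real (h (\<phi> t))) -
           of_real (integral {\<phi> p - \<eta>..\<phi> p + \<eta>} h) * (w p / of_real \<bar>f p\<bar>))
         \<le> e * integral {\<phi> p - \<eta>..\<phi> p + \<eta>} h"
proof -
  define C where "C = integral {\<phi> p - \<eta>..\<phi> p + \<eta>} h"
  have cont_phi: "continuous_on {c..d} \<phi>"
    using deriv by (rule DERIV_continuous_on)
  have whole: "integral {x..y} h = C" if "x \<le> \<phi> p - \<eta>" "\<phi> p + \<eta> \<le> y" for x y
  proof -
    have "(h has_integral C) {\<phi> p - \<eta>..\<phi> p + \<eta>}"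
      unfolding C_def
      by (intro integrable_integral integrable_continuous_interval continuous_on_subset[OF cont_h]) auto
    then have "(h has_integral C) {x..y}"
      by (rule has_integral_on_superset) (use that supp in auto)
    then show ?thesis by (rule integral_unique)
  qed
  obtain A B where AB: "\<phi> ` {c..d} = {A..B}"
    using connected_compact_interval_1[of "\<phi> ` {c..d}"] cont_phi
      connected_continuous_image[OF cont_phi] compact_continuous_image[OF cont_phi] by auto
  have subst: "((\<lambda>t. f t *\<^sub>R h (\<phi> t)) has_integral
      (integral {\<phi> c..\<phi> d} h - integral {\<phi> d..\<phi> c} h)) {c..d}"
    by (rule has_integral_substitution_general[of "{}" c d \<phi> A B])
      (use cd AB cont_phi deriv continuous_on_subset[OF cont_h] in auto)
  \<comment> \<open>The range of \<open>f\<close> on the interval is itself an interval and omits 0.\<close>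
  have same_sign: "f t > 0 \<longleftrightarrow> f p > 0" if "t \<in> {c..d}" for t
  proof (rule ccontr)
    assume "\<not> ?thesis"
    then have "f t \<le> 0 \<and> 0 \<le> f p \<or> f p \<le> 0 \<and> 0 \<le> f t" by auto
    moreover have "is_interval (f ` {c..d})"
      using connected_continuous_image[OF cont_f] by (simp add: is_interval_connected_1)
    moreover have "f t \<in> f ` {c..d}" "f p \<in> f ` {c..d}" using that cd by auto
    ultimately have "0 \<in> f ` {c..d}" by (metis mem_is_interval_1_I)
    then show False using nz by fastforce
  qed
  have slope: "\<exists>t\<in>{x<..<y}. \<phi> y - \<phi> x = f t * (y - x)" if "c \<le> x" "x < y" "y \<le> d" for x y
    by (rule mvt_simple[OF that(2), of \<phi> "\<lambda>t. (*) (f t)"])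
      (use that in \<open>auto intro!: has_derivative_subset[OF deriv[unfolded has_field_derivative_def]]\<close>)
  have mass: "((\<lambda>t. \<bar>f t\<bar> * h (\<phi> t)) has_integral C) {c..d}"
  proof (cases "f p > 0")
    case True
    have pos: "f t > 0" if "t \<in> {c..d}" for t
      using same_sign[OF that] True by simp
    have incr: "\<phi> x < \<phi> y" if xy: "c \<le> x" "x < y" "y \<le> d" for x y
    proof -
      obtain t where "t \<in> {x<..<y}" "\<phi> y - \<phi> x = f t * (y - x)"
        using slope[OF xy] by blast
      moreover from this have "f t * (y - x) > 0" using pos[of t] xy by auto
      ultimately show ?thesis by simp
    qed
    have "\<phi> c < \<phi> p" "\<phi> p < \<phi> d"
      using incr cd by auto
    then have "integral {\<phi> c..\<phi> d} h = C" "integral {\<phi> d..\<phi> c} h = 0"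
      using ends by (auto intro!: whole)
    then have "((\<lambda>t. f t *\<^sub>R h (\<phi> t)) has_integral C) {c..d}"
      using subst by simp
    then show ?thesis
      by (rule has_integral_eq[rotated]) (use pos in \<open>auto simp: abs_of_pos\<close>)
  next
    case False
    have neg: "f t < 0" if "t \<in> {c..d}" for t
      using same_sign[OF that] False nz[OF that] by simp
    have decr: "\<phi> y < \<phi> x" if xy: "c \<le> x" "x < y" "y \<le> d" for x y
    proof -
      obtain t where "t \<in> {x<..<y}" "\<phi> y - \<phi> x = f t * (y - x)"
        using slope[OF xy] by blast
      moreover from this have "f t * (y - x) < 0" using neg[of t] xy by (auto intro: mult_neg_pos)
      ultimately show ?thesis by simp
    qed
    have "\<phi> d < \<phi> p" "\<phi> p < \<phi> c"
      using decr cd by auto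
    then have "integral {\<phi> d..\<phi> c} h = C" "integral {\<phi> c..\<phi> d} h = 0"
      using ends by (auto intro!: whole)
    then have "((\<lambda>t. - (f t *\<^sub>R h (\<phi> t))) has_integral C) {c..d}"
      using has_integral_neg[OF subst] by simp
    then show ?thesis
      by (rule has_integral_eq[rotated]) (use neg in \<open>auto simp: abs_of_neg\<close>)
  qed
  have cont_hphi: "continuous_on {c..d} (\<lambda>t. h (\<phi> t))"
    using continuous_on_compose2[OF cont_h cont_phi] by auto
  have "((\<lambda>t. of_real (\<bar>f t\<bar> * h (\<phi> t)) * (w p / of_real \<bar>f p\<bar>)) has_integral
      (of_real C * (w p / of_real \<bar>f p\<bar>))) {c..d}"
    by (intro has_integral_mult_left has_integral_of_real mass)
  then have diff: "((\<lambda>t. w t * of_real (h (\<phi> t)) - of_real (\<bar>f t\<bar> * h (\<phi> t)) * (w p / of_real \<bar>f p\<bar>))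
      has_integral (integral {c..d} (\<lambda>t. w t * of_real (h (\<phi> t))) - of_real C * (w p / of_real \<bar>f p\<bar>))) {c..d}"
    by (intro has_integral_diff integrable_integral integrable_continuous_interval
        continuous_intros cont_w cont_hphi)
  have "norm (integral {c..d} (\<lambda>t. w t * of_real (h (\<phi> t))
            - of_real (\<bar>f t\<bar> * h (\<phi> t)) * (w p / of_real \<bar>f p\<bar>)))
      \<le> integral {c..d} (\<lambda>t. e * (\<bar>f t\<bar> * h (\<phi> t)))"
  proof (rule integral_norm_bound_integral)
    show "(\<lambda>t. w t * of_real (h (\<phi> t)) - of_real (\<bar>f t\<bar> * h (\<phi> t)) * (w p / of_real \<bar>f p\<bar>))
        integrable_on {c..d}"
      using diff by (rule has_integral_integrable)
    show "(\<lambda>t. e * (\<bar>f t\<bar> * h (\<phi> t))) integrable_on {c..d}"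
      using has_integral_integrable[OF mass] by (rule integrable_on_mult_right)
    show "norm (w t * of_real (h (\<phi> t)) - of_real (\<bar>f t\<bar> * h (\<phi> t)) * (w p / of_real \<bar>f p\<bar>))
        \<le> e * (\<bar>f t\<bar> * h (\<phi> t))" if t: "t \<in> {c..d}" for t
    proof -
      have "w t * of_real (h (\<phi> t)) - of_real (\<bar>f t\<bar> * h (\<phi> t)) * (w p / of_real \<bar>f p\<bar>)
          = (w t / of_real \<bar>f t\<bar> - w p / of_real \<bar>f p\<bar>) * of_real (\<bar>f t\<bar> * h (\<phi> t))"
        using nz[OF t] by (simp add: field_simps)
      also have "norm \<dots> = norm (w t / of_real \<bar>f t\<bar> - w p / of_real \<bar>f p\<bar>) * (\<bar>f t\<bar> * h (\<phi> t))"
        using h_nonneg by (simp add: norm_mult)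
      also have "\<dots> \<le> e * (\<bar>f t\<bar> * h (\<phi> t))"
        using osc[OF t] h_nonneg by (intro mult_right_mono) auto
      finally show ?thesis .
    qed
  qed
  also have "\<dots> = e * C"
    using integral_unique[OF mass] by simp
  finally show ?thesis
    unfolding C_def[symmetric] integral_unique[OF diff] .
qed

lemma tent_integral_pos:
  fixes y \<eta> :: real
  assumes "\<eta> > 0"
  shows "integral {y - \<eta>..y + \<eta>} (\<lambda>x. max 0 (\<eta> - \<bar>x - y\<bar>)) > 0"
proof -
  have int: "(\<lambda>x. max 0 (\<eta> - \<bar>x - y\<bar>)) integrable_on S" if "S = {u..v}" for S and u v :: real
    unfolding that by (intro integrable_continuous_interval continuous_intros)
  have "0 < integral {y - \<eta> / 2..y + \<eta> / 2} (\<lambda>_. \<eta> / 2)"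
    using assms by simp
  also have "\<dots> \<le> integral {y - \<eta> / 2..y + \<eta> / 2} (\<lambda>x. max 0 (\<eta> - \<bar>x - y\<bar>))"
    by (intro integral_le int[OF refl]) (auto simp: abs_le_iff max_def abs_if field_simps)
  also have "\<dots> \<le> integral {y - \<eta>..y + \<eta>} (\<lambda>x. max 0 (\<eta> - \<bar>x - y\<bar>))"
    using assms by (intro integral_subset_le int[OF refl]) auto
  finally show ?thesis .
qed

text \<open>
  A fibre point where the derivative does not vanish is isolated in the fibre; an accumulation point
  would belong to the fibre, which is closed.
\<close>

lemma finite_regular_fibre:
  fixes \<phi> f :: "real \<Rightarrow> real"
  assumes cont: "continuous_on {a..b} \<phi>"
    and deriv: "\<And>t. t \<in> {a..b} \<Longrightarrow> (\<phi> has_field_derivative f t) (at t within {a..b})"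
    and nz: "\<And>t. t \<in> {a..b} \<Longrightarrow> \<phi> t = y \<Longrightarrow> f t \<noteq> 0"
  shows "finite {t \<in> {a..b}. \<phi> t = y}"
proof -
  define B where "B = {t \<in> {a..b}. \<phi> t = y}"
  have "closed B"
    unfolding B_def by (rule continuous_closed_preimage_constant[OF cont closed_atLeastAtMost])
  have "\<not> z islimpt B" for z
  proof
    assume lim: "z islimpt B"
    then have "z \<in> B"
      using \<open>closed B\<close> by (meson closed_limpt)
    then have z: "z \<in> {a..b}" "\<phi> z = y"
      by (simp_all add: B_def)
    have "((\<lambda>t. (\<phi> t - \<phi> z) / (t - z)) \<longlongrightarrow> f z) (at z within {a..b})"
      using deriv[OF z(1)] by (simp add: has_field_derivative_iff)
    then have "eventually (\<lambda>t. (\<phi> t - \<phi> z) / (t - z) \<noteq> 0) (at z within {a..b})"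
      using nz[OF z] by (rule tendsto_imp_eventually_ne)
    then have "eventually (\<lambda>t. t \<notin> B) (at z)"
      unfolding eventually_at_filter by (rule eventually_mono) (auto simp: B_def z(2))
    then show False
      using lim by (simp add: islimpt_iff_eventually)
  qed
  then have "finite ({a..b} \<inter> B)"
    by (intro finite_not_islimpt_in_compact) auto
  moreover have "{a..b} \<inter> B = B"
    by (auto simp: B_def)
  ultimately show ?thesis
    by (simp add: B_def)
qed

text \<open>
  The intervals \<open>{p - r..p + r}\<close> around the fibre points are disjoint and so short that
  \<open>w t / of_real \<bar>f t\<bar>\<close> oscillates by at most \<open>e\<close> on each. Off their interiors \<open>\<phi>\<close> keeps a positive
  distance \<open>\<eta>\<close> from \<open>y\<close>, and the tent function of half-width \<open>\<eta>\<close> at \<open>y\<close> sees nothing else. Dividing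
  by the mass \<open>C\<close> of the tent bounds the fibre sum by \<open>e * card B\<close>.
\<close>

lemma (in vanishing_moments) weighted_fibre_sum_zero:
  assumes deriv: "\<And>t. t \<in> {a..b} \<Longrightarrow> (\<phi> has_field_derivative f t) (at t within {a..b})"
    and cont_f: "continuous_on {a..b} f"
    and fib: "B = {t \<in> {a..b}. \<phi> t = y}"
    and fin: "finite B"
    and ends: "\<phi> a \<noteq> y" "\<phi> b \<noteq> y"
    and nz: "\<And>p. p \<in> B \<Longrightarrow> f p \<noteq> 0"
  shows "(\<Sum>p\<in>B. w p / of_real \<bar>f p\<bar>) = 0"
proof (rule eq_zero_if_norm_le_mult)
  fix e :: real
  assume e: "e > 0"
  define u where "u t = w t / of_real \<bar>f t\<bar>" for t
  define good where "good p t \<longleftrightarrow> a < t \<and> t < b \<and> f t \<noteq> 0 \<and> norm (u t - u p) \<le> e" for p t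
  have inside: "a < p" "p < b" if "p \<in> B" for p
    using that ends by (auto simp: fib less_le)
  have "eventually (\<lambda>t. good p t) (nhds p)" if p: "p \<in> B" for p
  proof -
    have "isCont f p" "isCont w p"
      using cont_f cont_w inside[OF p] by (auto intro: continuous_on_interior)
    then have lim: "(f \<longlongrightarrow> f p) (nhds p)" "(w \<longlongrightarrow> w p) (nhds p)"
      by (simp_all add: continuous_at tendsto_at_iff_tendsto_nhds)
    have "(u \<longlongrightarrow> u p) (nhds p)"
      unfolding u_def using nz[OF p] lim by (intro tendsto_intros) auto
    from tendstoD[OF this e] have "eventually (\<lambda>t. norm (u t - u p) \<le> e) (nhds p)"
      by (rule eventually_mono) (simp add: dist_norm)
    moreover have "eventually (\<lambda>t. f t \<noteq> 0) (nhds p)"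
      using lim(1) nz[OF p] by (rule tendsto_imp_eventually_ne)
    moreover have "eventually (\<lambda>t. t \<in> {a<..<b}) (nhds p)"
      using inside[OF p] by (intro eventually_nhds_in_open) auto
    ultimately show ?thesis
      unfolding good_def by eventually_elim auto
  qed
  then have "eventually (\<lambda>r. \<forall>t\<in>{p - r..p + r}. good p t) (at_right 0)" if "p \<in> B" for p
  proof -
    obtain d where d: "d > 0" "\<And>t. dist t p < d \<Longrightarrow> good p t"
      using \<open>p \<in> B\<close> \<open>\<And>p. p \<in> B \<Longrightarrow> eventually (\<lambda>t. good p t) (nhds p)\<close>
      unfolding eventually_nhds_metric by blast
    have "eventually (\<lambda>r. r \<in> {0<..<d}) (at_right 0)"
      using d(1) by (rule eventually_at_right_real)
    then show ?thesis
      by (rule eventually_mono) (auto intro!: d(2) simp: dist_real_def abs_less_iff)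
  qed
  then have "eventually (\<lambda>r. \<forall>p\<in>B. \<forall>t\<in>{p - r..p + r}. good p t) (at_right 0)"
    using fin by (intro eventually_ball_finite) auto
  moreover have "eventually (\<lambda>r. \<forall>p\<in>B. \<forall>q\<in>B. p \<noteq> q \<longrightarrow> 2 * r < \<bar>p - q\<bar>) (at_right 0)"
  proof (intro eventually_ball_finite fin ballI)
    fix p q :: real
    show "eventually (\<lambda>r. p \<noteq> q \<longrightarrow> 2 * r < \<bar>p - q\<bar>) (at_right 0)"
    proof (cases "p = q")
      case False
      then have "eventually (\<lambda>r. r \<in> {0<..<\<bar>p - q\<bar> / 2}) (at_right 0)"
        by (intro eventually_at_right_real) auto
      then show ?thesis by (rule eventually_mono) auto
    qed auto
  qed
  ultimately have "eventually (\<lambda>r. 0 < r \<and> (\<forall>p\<in>B. \<forall>t\<in>{p - r..p + r}. good p t) \<and>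
      (\<forall>p\<in>B. \<forall>q\<in>B. p \<noteq> q \<longrightarrow> 2 * r < \<bar>p - q\<bar>)) (at_right 0)"
    using eventually_at_right_less[of 0] by eventually_elim auto
  then obtain r where r: "r > 0" and good: "\<And>p t. p \<in> B \<Longrightarrow> t \<in> {p - r..p + r} \<Longrightarrow> good p t"
    and sep: "\<And>p q. p \<in> B \<Longrightarrow> q \<in> B \<Longrightarrow> p \<noteq> q \<Longrightarrow> 2 * r < \<bar>p - q\<bar>"
    using eventually_happens'[OF trivial_limit_at_right_real] by blast
  define K where "K = {a..b} - (\<Union>p\<in>B. {p - r<..<p + r})"
  have "compact K"
    unfolding K_def by (intro compact_diff) auto
  then have "closed (\<phi> ` K)"
    using cont_phi by (intro compact_imp_closed compact_continuous_image)
      (auto simp: K_def intro: continuous_on_subset)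
  moreover have "y \<notin> \<phi> ` K"
    using r by (force simp: K_def fib)
  ultimately obtain \<eta> where eta: "\<eta> > 0" "\<And>x. x \<in> \<phi> ` K \<Longrightarrow> \<eta> \<le> dist y x"
    using separate_point_closed by metis
  have far: "\<eta> \<le> \<bar>\<phi> t - y\<bar>" if "t \<in> K" for t
    using eta(2)[of "\<phi> t"] that by (simp add: dist_real_def abs_minus_commute)
  define h where "h x = max 0 (\<eta> - \<bar>x - y\<bar>)" for x
  define C where "C = integral {y - \<eta>..y + \<eta>} h"
  have C: "C > 0"
    unfolding C_def h_def using eta(1) by (rule tent_integral_pos)
  have cont_h: "continuous_on S h" for S
    unfolding h_def by (intro continuous_intros)
  define L where "L p = integral {p - r..p + r} (\<lambda>t. w t * of_real (h (\<phi> t)))" for p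
  have sub: "{p - r..p + r} \<subseteq> {a..b}" if "p \<in> B" for p
    using good[OF that] by (force simp: good_def)
  have local: "norm (L p - of_real C * u p) \<le> e * C" if p: "p \<in> B" for p
  proof -
    have yp: "y = \<phi> p" using p by (simp add: fib)
    have in_K: "p - r \<in> K" "p + r \<in> K"
      using sub[OF p] r sep[OF p] by (force simp: K_def)+
    show ?thesis
      unfolding L_def u_def C_def yp
    proof (rule integral_near_regular_point)
      show "(\<phi> has_field_derivative f t) (at t within {p - r..p + r})" if "t \<in> {p - r..p + r}" for t
        using that sub[OF p] by (intro DERIV_subset[OF deriv]) auto
      show "norm (w t / of_real \<bar>f t\<bar> - w p / of_real \<bar>f p\<bar>) \<le> e" if "t \<in> {p - r..p + r}" for t
        using good[OF p that] by (simp add: good_def u_def)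
      show "f t \<noteq> 0" if "t \<in> {p - r..p + r}" for t
        using good[OF p that] by (simp add: good_def)
    qed (use r far[OF in_K(1)] far[OF in_K(2)] yp cont_h sub[OF p]
          in \<open>auto simp: h_def intro: continuous_on_subset[OF cont_f] continuous_on_subset[OF cont_w]\<close>)
  qed
  have "((\<lambda>t. w t * of_real (h (\<phi> t))) has_integral (\<Sum>p\<in>B. L p)) (\<Union>p\<in>B. {p - r..p + r})"
  proof (rule has_integral_UN[OF fin])
    fix p assume p: "p \<in> B"
    have "continuous_on {p - r..p + r} \<phi>" "continuous_on {p - r..p + r} w"
      using continuous_on_subset[OF cont_phi sub[OF p]] continuous_on_subset[OF cont_w sub[OF p]] by auto
    then show "((\<lambda>t. w t * of_real (h (\<phi> t))) has_integral L p) {p - r..p + r}"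
      unfolding L_def
      by (intro integrable_integral integrable_continuous_interval continuous_intros
          continuous_on_compose2[OF cont_h]) auto
  next
    show "pairwise (\<lambda>p q. negligible ({p - r..p + r} \<inter> {q - r..q + r})) B"
    proof (rule pairwiseI)
      fix p q assume "p \<in> B" "q \<in> B" "p \<noteq> q"
      then have "{p - r..p + r} \<inter> {q - r..q + r} = {}"
        using sep[of p q] by auto
      then show "negligible ({p - r..p + r} \<inter> {q - r..q + r})" by simp
    qed
  qed
  then have "((\<lambda>t. w t * of_real (h (\<phi> t))) has_integral (\<Sum>p\<in>B. L p)) {a..b}"
  proof (rule has_integral_spike_set_eq[THEN iffD1, rotated 2])
    have "{t \<in> (\<Union>p\<in>B. {p - r..p + r}) - {a..b}. w t * of_real (h (\<phi> t)) \<noteq> 0} = {}"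
      using sub by blast
    then show "negligible {t \<in> (\<Union>p\<in>B. {p - r..p + r}) - {a..b}. w t * of_real (h (\<phi> t)) \<noteq> 0}"
      by (simp only: negligible_empty)
  next
    have "w t * of_real (h (\<phi> t)) = 0" if "t \<in> {a..b} - (\<Union>p\<in>B. {p - r..p + r})" for t
    proof -
      have "t \<in> K" using that by (force simp: K_def)
      then show ?thesis using far by (simp add: h_def)
    qed
    then have "{t \<in> {a..b} - (\<Union>p\<in>B. {p - r..p + r}). w t * of_real (h (\<phi> t)) \<noteq> 0} = {}"
      by blast
    then show "negligible {t \<in> {a..b} - (\<Union>p\<in>B. {p - r..p + r}). w t * of_real (h (\<phi> t)) \<noteq> 0}"
      by (simp only: negligible_empty)
  qed
  then have "(\<Sum>p\<in>B. L p) = 0"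
    using integral_continuous_test[OF cont_h] by (simp add: has_integral_iff)
  then have "of_real C * (\<Sum>p\<in>B. u p) = - (\<Sum>p\<in>B. L p - of_real C * u p)"
    by (simp add: sum_subtractf sum_distrib_left)
  then have "C * norm (\<Sum>p\<in>B. u p) = norm (\<Sum>p\<in>B. L p - of_real C * u p)"
    using C by (metis norm_minus_cancel norm_mult norm_of_real abs_of_pos)
  also have "\<dots> \<le> of_nat (card B) * (e * C)"
    using local by (rule sum_norm_bound)
  finally have "norm (\<Sum>p\<in>B. u p) \<le> e * card B"
    using C by (simp add: mult_ac)
  then show "norm (\<Sum>p\<in>B. w p / of_real \<bar>f p\<bar>) \<le> e * card B"
    by (simp add: u_def)
qed

section \<open>Closed curves, vanishing moments and fibre sums\<close>

theorem theorem2p5: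
  fixes k f \<theta> \<phi> :: "real \<Rightarrow> real"
  assumes "continuous_on I2pi k" and "continuous_on I2pi f"
    and "\<And>t. t \<in> I2pi \<Longrightarrow> \<theta> t = integral {0..t} k"
    and "\<And>t. t \<in> I2pi \<Longrightarrow> \<phi> t = integral {0..t} f"
  shows
    "((\<forall>l::real. closed_curve (curve_of_curvature (\<lambda>t. k t + l * f t))) \<longleftrightarrow>
      (\<forall>n::nat. integral I2pi (\<lambda>t. cis (\<theta> t) * of_real (\<phi> t ^ n)) = 0)) \<and>
     ((\<forall>n::nat. integral I2pi (\<lambda>t. cis (\<theta> t) * of_real (\<phi> t ^ n)) = 0) \<longleftrightarrow>
      (\<forall>n::nat. \<forall>g. admissible \<phi> g \<longrightarrow>
         integral I2pi (\<lambda>t. cis (\<theta> t) * of_real (g (\<phi> t) ^ n)) = 0)) \<and>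
     ((\<forall>l::real. closed_curve (curve_of_curvature (\<lambda>t. k t + l * f t))) \<longrightarrow>
      (\<forall>a. a \<noteq> \<phi> 0 \<and> a \<noteq> \<phi> (2 * pi) \<and> regular_value \<phi> a \<longrightarrow>
         (\<Sum>b \<in> fibre \<phi> a. cis (\<theta> b) / of_real \<bar>deriv_on_I \<phi> b\<bar>) = 0))"
proof -
  define w where "w t = cis (\<theta> t)" for t
  have int_k: "k integrable_on {0..t}" and int_f: "f integrable_on {0..t}" if "t \<in> I2pi" for t
    using that assms(1,2)
    by (auto intro!: integrable_continuous_interval intro: continuous_on_subset)
  have deriv: "(\<phi> has_field_derivative f t) (at t within I2pi)" if t: "t \<in> I2pi" for t
  proof -
    have "((\<lambda>t. integral {0..t} f) has_vector_derivative f t) (at t within I2pi)"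
      using assms(2) t by (rule integral_has_vector_derivative)
    then have "(\<phi> has_vector_derivative f t) (at t within I2pi)"
      by (rule has_vector_derivative_transform[rotated 2]) (use assms(4) t in auto)
    then show ?thesis by (simp add: has_real_derivative_iff_has_vector_derivative)
  qed
  then have cont_phi: "continuous_on I2pi \<phi>"
    by (rule DERIV_continuous_on)
  have "continuous_on I2pi (\<lambda>t. integral {0..t} k)"
    using integrable_continuous_interval[OF assms(1)] by (rule indefinite_integral_continuous_1)
  then have cont_theta: "continuous_on I2pi \<theta>"
    by (rule continuous_on_eq) (use assms(3) in auto)
  then have cont_w: "continuous_on I2pi w"
    unfolding w_def by (intro continuous_intros)
  have closed_iff: "closed_curve (curve_of_curvature (\<lambda>t. k t + l * f t)) \<longleftrightarrow>
      integral I2pi (\<lambda>t. w t * cis (l * \<phi> t)) = 0" for l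
  proof -
    have "cis (tangent_angle (\<lambda>t. k t + l * f t) t) = w t * cis (l * \<phi> t)" if t: "t \<in> I2pi" for t
    proof -
      have "tangent_angle (\<lambda>t. k t + l * f t) t = \<theta> t + l * \<phi> t"
        using int_k[OF t] int_f[OF t] assms(3,4)[OF t]
        by (simp add: tangent_angle_def integral_add integrable_on_mult_right)
      then show ?thesis by (simp add: w_def cis_mult)
    qed
    then have "integral I2pi (\<lambda>t. cis (tangent_angle (\<lambda>t. k t + l * f t) t))
        = integral I2pi (\<lambda>t. w t * cis (l * \<phi> t))"
      by (rule integral_cong)
    then show ?thesis
      by (auto simp: closed_curve_def curve_of_curvature_def)
  qed
  have vm_iff: "vanishing_moments 0 (2 * pi) w \<phi> \<longleftrightarrow>
      (\<forall>n. integral I2pi (\<lambda>t. w t * of_real (\<phi> t ^ n)) = 0)"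
    using cont_w cont_phi by (auto simp: vanishing_moments_def)
  have closed_vm: "(\<forall>l. closed_curve (curve_of_curvature (\<lambda>t. k t + l * f t))) \<longleftrightarrow>
      vanishing_moments 0 (2 * pi) w \<phi>"
    unfolding closed_iff
  proof (intro iffI allI)
    assume "\<forall>l. integral I2pi (\<lambda>t. w t * cis (l * \<phi> t)) = 0"
    then show "vanishing_moments 0 (2 * pi) w \<phi>"
      by (intro cis_tests_imp_vanishing_moments cont_w cont_phi) simp
  next
    fix l assume "vanishing_moments 0 (2 * pi) w \<phi>"
    then show "integral I2pi (\<lambda>t. w t * cis (l * \<phi> t)) = 0"
      by (rule vanishing_moments.integral_cis_test)
  qed
  have vm_admissible: "integral I2pi (\<lambda>t. w t * of_real (g (\<phi> t) ^ n)) = 0"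
    if vm: "vanishing_moments 0 (2 * pi) w \<phi>" and g: "admissible \<phi> g" for g n
  proof -
    obtain G where G: "\<And>x. \<bar>g x\<bar> \<le> G"
      using g by (auto simp: admissible_def bounded_iff)
    show ?thesis
    proof (rule vanishing_moments.integral_bounded_test[OF vm, of "\<lambda>x. g x ^ n" "G ^ n"])
      show "\<bar>g x ^ n\<bar> \<le> G ^ n" for x
        using G by (simp add: power_abs power_mono)
      show "(\<lambda>t. g (\<phi> t) ^ n) \<in> borel_measurable (lebesgue_on I2pi)"
        using g by (auto simp: admissible_def)
    qed
  qed
  have admissible_vm: "vanishing_moments 0 (2 * pi) w \<phi>"
    if "\<forall>n g. admissible \<phi> g \<longrightarrow> integral I2pi (\<lambda>t. w t * of_real (g (\<phi> t) ^ n)) = 0"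
  proof -
    \<comment> \<open>The identity itself is neither bounded nor integrable, but only its values on the range matter.\<close>
    define g where "g x = indicator (\<phi> ` I2pi) x * x" for x
    have g_phi: "g (\<phi> t) = \<phi> t" if "t \<in> I2pi" for t
      using that by (simp add: g_def)
    have comp: "compact (\<phi> ` I2pi)"
      using cont_phi by (intro compact_continuous_image) auto
    have "bounded (range g)"
    proof -
      have "range g \<subseteq> insert 0 (\<phi> ` I2pi)"
        by (auto simp: g_def indicator_def)
      then show ?thesis
        using comp by (meson bounded_insert bounded_subset compact_imp_bounded)
    qed
    moreover have "integrable lebesgue g"
    proof -
      have "integrable lborel (\<lambda>x. indicator (\<phi> ` I2pi) x *\<^sub>R x)"
        using comp by (intro borel_integrable_compact continuous_intros)
      then have "integrable lborel g" by (simp add: g_def[abs_def])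
      then show ?thesis
        by (subst integrable_completion) auto
    qed
    moreover have "(\<lambda>t. g (\<phi> t)) \<in> borel_measurable (lebesgue_on I2pi)"
      using continuous_imp_measurable_on_sets_lebesgue[OF cont_phi] g_phi
      by (subst measurable_cong[of _ _ \<phi>]) auto
    ultimately have "admissible \<phi> g" by (simp add: admissible_def)
    then have "integral I2pi (\<lambda>t. w t * of_real (g (\<phi> t) ^ n)) = 0" for n
      using that by blast
    moreover have "integral I2pi (\<lambda>t. w t * of_real (g (\<phi> t) ^ n))
        = integral I2pi (\<lambda>t. w t * of_real (\<phi> t ^ n))" for n
      using g_phi by (intro integral_cong) auto
    ultimately show ?thesis by (simp add: vm_iff)
  qed
  have fibre_sum: "(\<Sum>b \<in> fibre \<phi> a. w b / of_real \<bar>deriv_on_I \<phi> b\<bar>) = 0"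
    if vm: "vanishing_moments 0 (2 * pi) w \<phi>"
      and a: "a \<noteq> \<phi> 0" "a \<noteq> \<phi> (2 * pi)" "regular_value \<phi> a" for a
  proof -
    have D: "deriv_on_I \<phi> t = f t" if "t \<in> I2pi" for t
      using deriv[OF that] that unfolding deriv_on_I_def
      by (intro vector_derivative_within_closed_interval)
        (auto simp: has_real_derivative_iff_has_vector_derivative)
    have nz: "f t \<noteq> 0" if "t \<in> I2pi" "\<phi> t = a" for t
      using a(3) D that by (auto simp: regular_value_def fibre_def)
    have "(\<Sum>b \<in> fibre \<phi> a. w b / of_real \<bar>f b\<bar>) = 0"
      using a nz finite_regular_fibre[OF cont_phi deriv nz]
      by (intro vanishing_moments.weighted_fibre_sum_zero[OF vm deriv assms(2), where y = a])
        (auto simp: fibre_def)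
    moreover have "(\<Sum>b \<in> fibre \<phi> a. w b / of_real \<bar>deriv_on_I \<phi> b\<bar>)
        = (\<Sum>b \<in> fibre \<phi> a. w b / of_real \<bar>f b\<bar>)"
      by (intro sum.cong) (auto simp: D fibre_def)
    ultimately show ?thesis by simp
  qed
  show ?thesis
    unfolding w_def[symmetric] closed_vm vm_iff[symmetric]
  proof (intro conjI)
    show "vanishing_moments 0 (2 * pi) w \<phi> \<longleftrightarrow>
        (\<forall>n g. admissible \<phi> g \<longrightarrow> integral I2pi (\<lambda>t. w t * of_real (g (\<phi> t) ^ n)) = 0)"
    proof
      assume "vanishing_moments 0 (2 * pi) w \<phi>"
      then show "\<forall>n g. admissible \<phi> g \<longrightarrow> integral I2pi (\<lambda>t. w t * of_real (g (\<phi> t) ^ n)) = 0"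
        by (intro allI impI vm_admissible)
    qed (rule admissible_vm)
    show "vanishing_moments 0 (2 * pi) w \<phi> \<longrightarrow>
        (\<forall>a. a \<noteq> \<phi> 0 \<and> a \<noteq> \<phi> (2 * pi) \<and> regular_value \<phi> a \<longrightarrow>
          (\<Sum>b \<in> fibre \<phi> a. w b / of_real \<bar>deriv_on_I \<phi> b\<bar>) = 0)"
      by (simp add: fibre_sum)
  qed (rule refl)
qed

end
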